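(* Let $L$ be a non-Lie complex filiform Leibniz algebra in $SLeib_5$. Then $L$ is isomorphic to one of the following pairwise non-isomorphic Leibniz algebras: 1) $L(1,0,\lambda)$, $\lambda\in\mathbb{C}$; 2) $L(1,1,2)$; 3) $L(0,0,1)$; 4) $L(0,1,0)$; 5) $L(0,0,0)$.
   Context: A Leibniz algebra is a vector space with a bilinear product satisfying $[x,[y,z]]=[[x,y],z]-[[x,z],y]$. Put $L^1=L$, $L^{k+1}=[L^k,L]$; an $m$-dimensional Leibniz algebra $L$ is filiform if $\dim L^i=m-i$ for $2\le i\le m$. For $(\beta_3,\beta_4,\gamma)\in\mathbb{C}^3$, $L(\beta_3,\beta_4,\gamma)$ denotes the 5-dimensional complex Leibniz algebra with basis $e_0,e_1,e_2,e_3,e_4$ and products $[e_0,e_0]=e_2$, $[e_i,e_0]=e_{i+1}$ for $2\le i\le 3$, $[e_0,e_1]=\beta_3e_3+\beta_4e_4$, $[e_1,e_1]=\gamma e_4$, $[e_2,e_1]=\beta_3e_4$, all other products of basis vectors being zero. $SLeib_5$ is the class of 5-dimensional non-Lie complex filiform Leibniz algebras that admit a basis with such a multiplication table for some $(\beta_3,\beta_4,\gamma)$. *)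

theory Defs
  imports "HOL-Analysis.Analysis"
begin

locale bilinear_product = vector_space scale
  for scale :: "'k::field \<Rightarrow> 'a::ab_group_add \<Rightarrow> 'a" +
  fixes br :: "'a \<Rightarrow> 'a \<Rightarrow> 'a"
  assumes linear_left: "Vector_Spaces.linear scale scale (\<lambda>x. br x y)"
    and linear_right: "Vector_Spaces.linear scale scale (br x)"

locale lie_algebra = bilinear_product scale br
  for scale :: "'k::field \<Rightarrow> 'a::ab_group_add \<Rightarrow> 'a"
    and br :: "'a \<Rightarrow> 'a \<Rightarrow> 'a" +
  assumes alternating: "br x x = 0"
    and jacobi: "br x (br y z) + br y (br z x) + br z (br x y) = 0"

locale leibniz_algebra = bilinear_product scale br
  for scale :: "'k::field \<Rightarrow> 'a::ab_group_add \<Rightarrow> 'a"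
    and br :: "'a \<Rightarrow> 'a \<Rightarrow> 'a" +
  assumes leibniz: "br x (br y z) = br (br x y) z - br (br x z) y"
begin

text \<open>\<open>lower_central k\<close> is $L^k$, with indexing from $L^1 = L$; the value at
  0 is a dummy.\<close>

fun lower_central :: "nat \<Rightarrow> 'a set" where
  "lower_central 0 = UNIV"
| "lower_central (Suc 0) = UNIV"
| "lower_central (Suc (Suc k)) = span {br x y | x y. x \<in> lower_central (Suc k)}"

text \<open>In the library, \<open>dim\<close> is 0 for an infinite-dimensional space, so for \<open>m > 0\<close> the first
  conjunct includes finite-dimensionality.\<close>

definition filiform :: "nat \<Rightarrow> bool" where
  "filiform m \<longleftrightarrow> dim UNIV = m \<and> (\<forall>i\<in>{2..m}. dim (lower_central i) = m - i)"

end

definition leibniz_isomorphic ::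
  "('k::field \<Rightarrow> 'a::ab_group_add \<Rightarrow> 'a) \<Rightarrow> ('a \<Rightarrow> 'a \<Rightarrow> 'a) \<Rightarrow>
   ('k \<Rightarrow> 'b::ab_group_add \<Rightarrow> 'b) \<Rightarrow> ('b \<Rightarrow> 'b \<Rightarrow> 'b) \<Rightarrow> bool" where
  "leibniz_isomorphic s1 br1 s2 br2 \<longleftrightarrow>
     (\<exists>f. Vector_Spaces.linear s1 s2 f \<and> bij f \<and> (\<forall>x y. f (br1 x y) = br2 (f x) (f y)))"

text \<open>The product of the \<open>i\<close>-th and \<open>j\<close>-th of five vectors \<open>e 0, \<dots>, e 4\<close> prescribed by the
  multiplication table. The index type \<open>5\<close> has exactly the elements \<open>0, 1, 2, 3, 4\<close>.\<close>

definition SLeib5_table ::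
  "(complex \<Rightarrow> 'a::ab_group_add \<Rightarrow> 'a) \<Rightarrow> (5 \<Rightarrow> 'a) \<Rightarrow> complex \<times> complex \<times> complex \<Rightarrow> 5 \<Rightarrow> 5 \<Rightarrow> 'a"
where
  "SLeib5_table s e = (\<lambda>(\<beta>3, \<beta>4, \<gamma>) i j.
     if i = 0 \<and> j = 0 then e 2
     else if i = 2 \<and> j = 0 then e 3
     else if i = 3 \<and> j = 0 then e 4
     else if i = 0 \<and> j = 1 then s \<beta>3 (e 3) + s \<beta>4 (e 4)
     else if i = 1 \<and> j = 1 then s \<gamma> (e 4)
     else if i = 2 \<and> j = 1 then s \<beta>3 (e 4)
     else 0)"

text \<open>The product of $L(\beta_3,\beta_4,\gamma)$: the bilinear extension of the table from the
  standard basis of \<open>complex ^ 5\<close>, which carries the complex scalar multiplication \<open>(*s)\<close>.\<close>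

definition SL :: "complex \<times> complex \<times> complex \<Rightarrow> complex ^ 5 \<Rightarrow> complex ^ 5 \<Rightarrow> complex ^ 5" where
  "SL p x y = (\<Sum>i\<in>UNIV. \<Sum>j\<in>UNIV. (x $ i * y $ j) *s SLeib5_table (*s) (\<lambda>k. axis k 1) p i j)"

definition SLeib5 :: "(complex \<Rightarrow> 'a::ab_group_add \<Rightarrow> 'a) \<Rightarrow> ('a \<Rightarrow> 'a \<Rightarrow> 'a) \<Rightarrow> bool" where
  "SLeib5 s br \<longleftrightarrow>
     leibniz_algebra s br \<and>
     \<not> lie_algebra s br \<and>
     leibniz_algebra.filiform s br 5 \<and>
     (\<exists>p e. inj e \<and> \<not> module.dependent s (range e) \<and> module.span s (range e) = UNIV \<and>
        (\<forall>i j. br (e i) (e j) = SLeib5_table s e p i j))"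

definition SLeib5_list :: "(complex \<times> complex \<times> complex) set" where
  "SLeib5_list = {(1, 0, l) | l. True} \<union> {(1, 1, 2), (0, 0, 1), (0, 1, 0), (0, 0, 0)}"

end

theory Submission
  imports Defs
begin

text \<open>
  An isomorphism is determined by the images of \<open>e\<^sub>0\<close> and \<open>e\<^sub>1\<close>. The relation
  \<open>[e\<^sub>1, e\<^sub>0] = 0\<close> forces \<open>f e\<^sub>0 = A e\<^sub>0 + B e\<^sub>1 + \<dots>\<close> and \<open>f e\<^sub>1 = D e\<^sub>1 + \<dots>\<close> with
  \<open>A, D \<noteq> 0\<close>, and comparing coefficients shows that the parameters transform by
  \<open>\<beta>\<^sub>3' = D \<beta>\<^sub>3 / A\<^sup>2\<close>, \<open>\<beta>\<^sub>4' = D (A \<beta>\<^sub>4 + B (\<gamma> - 2 \<beta>\<^sub>3\<^sup>2)) / A\<^sup>4\<close>, \<open>\<gamma>' = D\<^sup>2 \<gamma> / A\<^sup>4\<close>; conversely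
  every such \<open>A, B, D\<close> occurs. Hence \<open>\<beta>\<^sub>3\<close> can be scaled to 1 if nonzero, which leaves
  \<open>\<gamma> / \<beta>\<^sub>3\<^sup>2\<close> invariant, and \<open>\<beta>\<^sub>4\<close> can be removed unless \<open>\<gamma> = 2 \<beta>\<^sub>3\<^sup>2\<close>.
\<close>

section \<open>Coordinates of the product\<close>

lemma UNIV_5: "(UNIV :: 5 set) = {0, 1, 2, 3, 4}"
proof -
  have "card {0, 1, 2, 3, 4 :: 5} = CARD(5)" by simp
  then show ?thesis by (metis card_subset_eq finite subset_UNIV)
qed

lemma forall_5: "(\<forall>i::5. P i) \<longleftrightarrow> P 0 \<and> P 1 \<and> P 2 \<and> P 3 \<and> P 4"
  by (metis UNIV_5 UNIV_I insertE empty_iff)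

lemma sum_5: "(\<Sum>i\<in>UNIV. f (i::5)) = f 0 + f 1 + f 2 + f 3 + f 4"
  unfolding UNIV_5 by (simp add: add.assoc)

text \<open>Turns identities between products into scalar polynomial identities, one per
  coordinate.\<close>

lemma SL_nth:
  "SL (b3, b4, g) x y $ 0 = 0"
  "SL (b3, b4, g) x y $ 1 = 0"
  "SL (b3, b4, g) x y $ 2 = x $ 0 * y $ 0"
  "SL (b3, b4, g) x y $ 3 = x $ 2 * y $ 0 + b3 * (x $ 0 * y $ 1)"
  "SL (b3, b4, g) x y $ 4 = x $ 3 * y $ 0 + b4 * (x $ 0 * y $ 1) + g * (x $ 1 * y $ 1)
     + b3 * (x $ 2 * y $ 1)"
  by (simp_all add: SL_def sum_5 SLeib5_table_def axis_def algebra_simps)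

lemma leibniz_algebra_SL: "leibniz_algebra (*s) (SL p)"
proof (cases p)
  case (fields b3 b4 g)
  show ?thesis
    unfolding fields
    by unfold_locales
      (auto simp: vec_eq_iff forall_5 SL_nth algebra_simps)
qed

section \<open>Isomorphisms and the coordinate model\<close>

lemma leibniz_isomorphic_trans:
  assumes "leibniz_isomorphic s1 br1 s2 br2" "leibniz_isomorphic s2 br2 s3 br3"
  shows "leibniz_isomorphic s1 br1 s3 br3"
proof -
  obtain f where f: "Vector_Spaces.linear s1 s2 f" "bij f" "\<And>x y. f (br1 x y) = br2 (f x) (f y)"
    using assms(1) unfolding leibniz_isomorphic_def by blast
  obtain g where g: "Vector_Spaces.linear s2 s3 g" "bij g" "\<And>x y. g (br2 x y) = br3 (g x) (g y)"
    using assms(2) unfolding leibniz_isomorphic_def by blast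
  have "Vector_Spaces.linear s1 s3 (g \<circ> f)"
    using Vector_Spaces.linear_compose f(1) g(1) .
  then show ?thesis
    unfolding leibniz_isomorphic_def
    by (intro exI[of _ "g \<circ> f"]) (simp add: bij_comp f g)
qed

lemma leibniz_isomorphic_sym:
  assumes "leibniz_isomorphic s1 br1 s2 br2"
  shows "leibniz_isomorphic s2 br2 s1 br1"
proof -
  obtain f where f: "Vector_Spaces.linear s1 s2 f" "bij f" "\<And>x y. f (br1 x y) = br2 (f x) (f y)"
    using assms unfolding leibniz_isomorphic_def by blast
  interpret Vector_Spaces.linear s1 s2 f by (fact f(1))
  have f_inv: "f (inv f y) = y" for y
    using f(2) by (simp add: bij_is_surj surj_f_inv_f)
  have eqI: "x = y" if "f x = f y" for x y
    using f(2) that by (meson bij_is_inj injD)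
  have "Vector_Spaces.linear s2 s1 (inv f)"
    by (unfold_locales; rule eqI) (simp_all add: f_inv add scale)
  moreover have "inv f (br2 x y) = br1 (inv f x) (inv f y)" for x y
    by (rule eqI) (simp add: f_inv f(3))
  ultimately show ?thesis
    unfolding leibniz_isomorphic_def using f(2) bij_imp_bij_inv by blast
qed

text \<open>The linear map taking \<open>axis i 1\<close> to \<open>e i\<close> is bijective because
  \<open>e\<close> is a basis, and multiplicative because both products are bilinear with the same
  table.\<close>

lemma SL_isomorphic_if_table:
  fixes s :: "complex \<Rightarrow> 'a::ab_group_add \<Rightarrow> 'a" and e :: "5 \<Rightarrow> 'a"
  assumes br: "bilinear_product s br"
    and e: "inj e" "\<not> module.dependent s (range e)" "module.span s (range e) = UNIV"
    and table: "\<And>i j. br (e i) (e j) = SLeib5_table s e p i j"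
  shows "leibniz_isomorphic (*s) (SL p) s br"
proof -
  interpret bilinear_product s br by (fact br)
  obtain b3 b4 g where p: "p = (b3, b4, g)" by (cases p)
  define f where "f x = (\<Sum>i\<in>UNIV. s (x $ i) (e i))" for x
  have lin: "Vector_Spaces.linear (*s) s f"
    by unfold_locales
      (simp_all add: f_def scale_left_distrib scale_right_distrib sum.distrib scale_sum_right vector_smult_assoc)
  interpret f: Vector_Spaces.linear "(*s)" s f by (fact lin)
  have "inj f"
  proof -
    have "x = 0" if "f x = 0" for x
    proof -
      have "(\<Sum>v\<in>range e. s (x $ inv e v) v) = 0"
        using that e(1) by (simp add: sum.reindex f_def)
      then have "x $ i = 0" for i
        using independentD[OF e(2), of "range e" "\<lambda>v. x $ inv e v" "e i"] e(1)
        by simp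
      then show ?thesis by (simp add: vec_eq_iff)
    qed
    then show ?thesis by (simp add: f.inj_iff_eq_0)
  qed
  moreover have "surj f"
  proof -
    have "e i \<in> range f" for i
      by (rule range_eqI[of _ _ "axis i 1"])
        (simp add: f_def axis_def if_distrib[of "\<lambda>a. s a _"] cong: if_cong)
    moreover have "subspace (range f)"
      by (simp add: f.subspace_image)
    ultimately have "span (range e) \<subseteq> range f"
      by (intro span_minimal) auto
    then show ?thesis using e(3) by blast
  qed
  moreover have "f (SL p x y) = br (f x) (f y)" for x y
  proof -
    have l: "br (\<Sum>i\<in>UNIV. s (x $ i) (e i)) z = (\<Sum>i\<in>UNIV. s (x $ i) (br (e i) z))" for z
    proof -
      interpret Vector_Spaces.linear s s "\<lambda>x. br x z" by (fact linear_left)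
      show ?thesis by (simp add: sum scale)
    qed
    have r: "br z (\<Sum>i\<in>UNIV. s (y $ i) (e i)) = (\<Sum>i\<in>UNIV. s (y $ i) (br z (e i)))" for z
    proof -
      interpret Vector_Spaces.linear s s "br z" by (fact linear_right)
      show ?thesis by (simp add: sum scale)
    qed
    have "br (f x) (f y) = (\<Sum>i\<in>UNIV. s (x $ i) (\<Sum>j\<in>UNIV. s (y $ j) (SLeib5_table s e p i j)))"
      unfolding f_def l by (simp add: r table)
    also have "\<dots> = f (SL p x y)"
      by (simp add: f_def sum_5 p SLeib5_table_def SL_nth scale_left_distrib scale_right_distrib mult_ac add_ac)
    finally show ?thesis by simp
  qed
  ultimately show ?thesis
    unfolding leibniz_isomorphic_def using lin by (auto simp: bij_def)
qed

section \<open>Change of parameters under isomorphism\<close>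

text \<open>\<open>A\<close> and \<open>B\<close> are the coordinates 0 and 1 of the image of the
  first basis vector, \<open>D\<close> is coordinate 1 of the image of the second. The other
  coordinates of these images drop out of the comparison.\<close>

lemma SL_isomorphic_iff:
  "leibniz_isomorphic (*s) (SL (b3', b4', g')) (*s) (SL (b3, b4, g)) \<longleftrightarrow>
    (\<exists>A B D. A \<noteq> 0 \<and> D \<noteq> 0 \<and> b3' * A^2 = D * b3 \<and>
      b4' * A^4 = D * (A * b4 + B * (g - 2 * b3^2)) \<and> g' * A^4 = D^2 * g)"
    (is "?iso \<longleftrightarrow> ?crit")
proof
  assume ?iso
  then obtain f where lin: "Vector_Spaces.linear (*s) (*s) f" and "inj f"
    and hom: "\<And>x y. f (SL (b3', b4', g') x y) = SL (b3, b4, g) (f x) (f y)"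
    unfolding leibniz_isomorphic_def by (auto simp: bij_def)
  interpret Vector_Spaces.linear "(*s)" "(*s)" f by (fact lin)
  define E :: "5 \<Rightarrow> complex ^ 5" where "E i = axis i 1" for i
  define a where "a = f (E 0)"
  define b where "b = f (E 1)"
  have nz: "f x \<noteq> 0" if "x \<noteq> 0" for x
    using \<open>inj f\<close> that zero by (metis injD)
  have E_nz: "E i \<noteq> 0" for i
    by (simp add: E_def axis_eq_0_iff)
  have E: "SL (b3', b4', g') (E 0) (E 0) = E 2" "SL (b3', b4', g') (E 2) (E 0) = E 3"
    "SL (b3', b4', g') (E 3) (E 0) = E 4" "SL (b3', b4', g') (E 1) (E 0) = 0"
    "SL (b3', b4', g') (E 0) (E 1) = b3' *s E 3 + b4' *s E 4"
    "SL (b3', b4', g') (E 1) (E 1) = g' *s E 4"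
    by (simp_all add: vec_eq_iff forall_5 SL_nth E_def axis_def)
  let ?m = "SL (b3, b4, g)"
  have f2: "f (E 2) = ?m a a"
    using hom[of "E 0" "E 0"] by (simp add: E a_def)
  have f3: "f (E 3) = ?m (?m a a) a"
    using hom[of "E 2" "E 0"] by (simp add: E a_def f2)
  have f4: "f (E 4) = ?m (?m (?m a a) a) a"
    using hom[of "E 3" "E 0"] by (simp add: E a_def f3)
  have h10: "?m b a = 0"
    using hom[of "E 1" "E 0"] by (simp add: E a_def b_def)
  have h01: "?m a b = b3' *s ?m (?m a a) a + b4' *s ?m (?m (?m a a) a) a"
    using hom[of "E 0" "E 1"] by (simp add: E a_def b_def f3 f4 add scale)
  have h11: "?m b b = g' *s ?m (?m (?m a a) a) a"
    using hom[of "E 1" "E 1"] by (simp add: E b_def f4 scale)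
  \<comment> \<open>Otherwise \<open>?m a a\<close> is a multiple of the last basis vector, which
    annihilates everything from the left.\<close>
  have A: "a $ 0 \<noteq> 0"
  proof
    assume "a $ 0 = 0"
    then have "f (E 3) = 0" by (simp add: f3 vec_eq_iff forall_5 SL_nth)
    then show False using nz E_nz by blast
  qed
  have b0: "b $ 0 = 0"
    using h10 A by (simp add: vec_eq_iff forall_5 SL_nth)
  have b2: "b $ 2 = 0"
    using h10 A by (simp add: vec_eq_iff forall_5 SL_nth b0)
  \<comment> \<open>Otherwise \<open>b\<close> is a multiple of the last basis vector. So is
    \<open>f (E 4)\<close>, with coefficient \<open>(a $ 0)^4\<close>, hence a combination of
    \<open>E 1\<close> and \<open>E 4\<close> would lie in the kernel.\<close>
  have D: "b $ 1 \<noteq> 0"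
  proof
    assume b1: "b $ 1 = 0"
    then have b3: "b $ 3 = 0"
      using h10 A by (simp add: vec_eq_iff forall_5 SL_nth b0 b2)
    have "f (E 1 - (b $ 4 / (a $ 0)^4) *s E 4) = 0"
      using A by (simp add: diff scale f4 b_def[symmetric] vec_eq_iff forall_5 SL_nth b0 b1 b2 b3 power4_eq_xxxx)
    moreover have "(E 1 - (b $ 4 / (a $ 0)^4) *s E 4) $ 1 = 1"
      by (simp add: E_def axis_def)
    ultimately show False using nz zero_index zero_neq_one by metis
  qed
  have eq3: "b3' * (a $ 0)^2 = b $ 1 * b3"
    using h01 A by (simp add: vec_eq_iff forall_5 SL_nth b0 b2 power2_eq_square mult.commute)
  \<comment> \<open>Coordinate 4 of \<open>h01\<close>. Inserting \<open>eq3\<close> then cancels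
    the terms in \<open>a $ 2\<close>, and the term \<open>2 * a $ 1 * b3\<close> becomes the
    correction \<open>- 2 * b3^2\<close>.\<close>
  have e: "b4 * (a $ 0 * b $ 1) + g * (a $ 1 * b $ 1) + b3 * (a $ 2 * b $ 1) =
      b3' * (a $ 0)^2 * (a $ 2 + 2 * a $ 1 * b3) + b4' * (a $ 0)^4"
    using h01 by (simp add: vec_eq_iff forall_5 SL_nth b0 b2 power2_eq_square power4_eq_xxxx algebra_simps)
  have eq4: "b4' * (a $ 0)^4 = b $ 1 * (a $ 0 * b4 + a $ 1 * (g - 2 * b3^2))"
    using e unfolding eq3 by (simp add: power2_eq_square algebra_simps)
  have eq5: "g' * (a $ 0)^4 = (b $ 1)^2 * g"
    using h11 by (simp add: vec_eq_iff forall_5 SL_nth b0 b2 power2_eq_square power4_eq_xxxx algebra_simps)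
  show ?crit
    using A D eq3 eq4 eq5 by blast
next
  assume ?crit
  then obtain A B D where nz: "A \<noteq> 0" "D \<noteq> 0" and
    eq: "b3' * A^2 = D * b3" "b4' * A^4 = D * (A * b4 + B * (g - 2 * b3^2))" "g' * A^4 = D^2 * g"
    by blast
  \<comment> \<open>The \<open>e\<^sub>3\<close>-coefficient \<open>- B D g / A\<close> of the image of \<open>e\<^sub>1\<close> preserves \<open>[e\<^sub>1, e\<^sub>0] = 0\<close>; the
    images of \<open>e\<^sub>2, e\<^sub>3, e\<^sub>4\<close> are then products.\<close>
  define F :: "complex ^ 5 \<Rightarrow> 5 \<Rightarrow> complex" where "F x i =
    (if i = 0 then A * x $ 0
     else if i = 1 then B * x $ 0 + D * x $ 1
     else if i = 2 then A^2 * x $ 2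
     else if i = 3 then A^3 * x $ 3 + A * B * b3 * x $ 2 - B * D * g / A * x $ 1
     else A^4 * x $ 4 + 2 * A^2 * B * b3 * x $ 3 + (A * B * b4 + B^2 * g) * x $ 2)" for x i
  define f :: "complex ^ 5 \<Rightarrow> complex ^ 5" where "f x = (\<chi> i. F x i)" for x
  have f_nth: "f x $ i = F x i" for x i by (simp add: f_def)
  have lin: "Vector_Spaces.linear (*s) (*s) f"
    by unfold_locales
      (auto simp: vec_eq_iff forall_5 f_nth F_def add_divide_distrib algebra_simps)
  interpret Vector_Spaces.linear "(*s)" "(*s)" f by (fact lin)
  have "inj f"
    unfolding inj_iff_eq_0 using nz by (auto simp: vec_eq_iff forall_5 f_nth F_def)
  moreover from this have "surj f"
    using vec.linear_inj_imp_surj[OF lin] by blast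
  moreover have "f (SL (b3', b4', g') x y) = SL (b3, b4, g) (f x) (f y)" for x y
  proof -
    have eq': "b3' = D * b3 / A^2" "b4' = D * (A * b4 + B * (g - 2 * b3^2)) / A^4"
      "g' = D^2 * g / A^4"
      using eq nz by (simp_all add: eq_divide_eq)
    have "F (SL (b3', b4', g') x y) 4 = SL (b3, b4, g) (f x) (f y) $ 4"
      unfolding eq' using nz
      by (simp add: SL_nth f_nth F_def field_simps power2_eq_square power3_eq_cube power4_eq_xxxx)
    moreover have "F (SL (b3', b4', g') x y) 3 = SL (b3, b4, g) (f x) (f y) $ 3"
      unfolding eq' using nz
      by (simp add: SL_nth f_nth F_def field_simps power2_eq_square power3_eq_cube)
    ultimately show ?thesis
      unfolding vec_eq_iff forall_5 f_nth
      by (simp add: SL_nth f_nth F_def power2_eq_square)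
  qed
  ultimately show ?iso
    unfolding leibniz_isomorphic_def using lin by (auto simp: bij_def)
qed

section \<open>Normal forms and their separation\<close>

lemma SL_isomorphic_normal_form:
  "\<exists>q\<in>SLeib5_list. leibniz_isomorphic (*s) (SL q) (*s) (SL p)"
proof -
  obtain b3 b4 g where p: "p = (b3, b4, g)" by (cases p)
  \<comment> \<open>The factor through which \<open>B\<close> acts on the second parameter: if it is
    nonzero, \<open>B\<close> can be chosen to make that parameter vanish.\<close>
  define c where "c = g - 2 * b3^2"
  have witness: ?thesis
    if "(x, y, z) \<in> SLeib5_list" "A \<noteq> 0" "D \<noteq> 0" "x * A^2 = D * b3"
      "y * A^4 = D * (A * b4 + B * c)" "z * A^4 = D^2 * g" for x y z A B D
    using that unfolding p c_def by (blast intro: SL_isomorphic_iff[THEN iffD2])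
  consider "b3 \<noteq> 0" "c \<noteq> 0" | "b3 \<noteq> 0" "c = 0" "b4 = 0" | "b3 \<noteq> 0" "c = 0" "b4 \<noteq> 0"
    | "b3 = 0" "g \<noteq> 0" | "b3 = 0" "g = 0" "b4 \<noteq> 0" | "b3 = 0" "g = 0" "b4 = 0"
    by blast
  then show ?thesis
  proof cases
    case 1
    then show ?thesis
      by (intro witness[of 1 0 "g / b3^2" 1 "1 / b3" "- b4 / c"])
        (simp_all add: SLeib5_list_def power_divide)
  next
    case 2
    then show ?thesis
      by (intro witness[of 1 0 "g / b3^2" 1 "1 / b3" 0])
        (simp_all add: SLeib5_list_def power_divide)
  next
    case 3
    \<comment> \<open>Normalizing the first parameter to 1 forces \<open>D = A^2 / b3\<close>. As
      \<open>c = 0\<close>, the second parameter then becomes \<open>b4 / (A * b3)\<close>, which is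
      1 for this \<open>A\<close>.\<close>
    let ?A = "b4 / b3"
    from 3 have "g = 2 * b3^2" by (simp add: c_def)
    with 3 show ?thesis
      by (intro witness[of 1 1 2 ?A "?A^2 / b3" 0])
        (simp_all add: SLeib5_list_def field_simps eval_nat_numeral)
  next
    case 4
    \<comment> \<open>With \<open>A = 1\<close>, scaling the third parameter to 1 requires
      \<open>D^2 = 1 / g\<close>, hence a square root of \<open>g\<close>. Here
      \<open>c = g\<close>.\<close>
    define r where "r = csqrt g"
    have r: "r \<noteq> 0" "g = r^2" using 4 by (simp_all add: r_def)
    show ?thesis
      by (rule witness[of 0 0 1 1 "1 / r" "- b4 / g"])
        (use 4 r in \<open>simp_all add: SLeib5_list_def c_def power_divide\<close>)
  next
    case 5
    then show ?thesis
      by (intro witness[of 0 1 0 1 "1 / b4" 0]) (simp_all add: SLeib5_list_def)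
  next
    case 6
    then show ?thesis
      by (intro witness[of 0 0 0 1 1 0]) (simp_all add: SLeib5_list_def)
  qed
qed

text \<open>Vanishing of the first and of the third parameter is invariant. If
  \<open>z = 2 * x^2\<close>, the term in \<open>B\<close> disappears and vanishing of the second
  parameter is invariant too; this separates \<open>(1, 1, 2)\<close> from \<open>(1, 0, 2)\<close>
  and \<open>(0, 1, 0)\<close> from \<open>(0, 0, 0)\<close>.\<close>

lemma SLeib5_list_eqI:
  assumes "p \<in> SLeib5_list" "q \<in> SLeib5_list" "leibniz_isomorphic (*s) (SL p) (*s) (SL q)"
  shows "p = q"
proof -
  obtain x' y' z' x y z where pq: "p = (x', y', z')" "q = (x, y, z)"
    by (cases p, cases q)
  obtain A B D where nz: "A \<noteq> 0" "D \<noteq> 0" and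
    eq: "x' * A^2 = D * x" "y' * A^4 = D * (A * y + B * (z - 2 * x^2))" "z' * A^4 = D^2 * z"
    using assms(3) unfolding pq SL_isomorphic_iff by blast
  have "z' = z" if "x' = 1" "x = 1"
  proof -
    have "D = A^2" using eq(1) that by simp
    then have "D^2 = A^4" by simp
    then show ?thesis using eq(3) nz by simp
  qed
  then show ?thesis
    using assms(1,2) nz eq unfolding pq SLeib5_list_def by auto
qed

theorem theorem4p1:
  fixes s :: "complex \<Rightarrow> 'a::ab_group_add \<Rightarrow> 'a"
    and br :: "'a \<Rightarrow> 'a \<Rightarrow> 'a"
  shows "(SLeib5 s br \<longrightarrow> (\<exists>p\<in>SLeib5_list. leibniz_isomorphic s br (*s) (SL p)))
    \<and> (\<forall>p\<in>SLeib5_list. leibniz_algebra (*s) (SL p))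
    \<and> pairwise (\<lambda>p q. \<not> leibniz_isomorphic (*s) (SL p) (*s) (SL q)) SLeib5_list"
proof (intro conjI)
  show "SLeib5 s br \<longrightarrow> (\<exists>p\<in>SLeib5_list. leibniz_isomorphic s br (*s) (SL p))"
  proof
    assume "SLeib5 s br"
    then obtain p e where "leibniz_algebra s br" "inj e" "\<not> module.dependent s (range e)"
      "module.span s (range e) = UNIV" "\<And>i j. br (e i) (e j) = SLeib5_table s e p i j"
      unfolding SLeib5_def by blast
    then have "leibniz_isomorphic (*s) (SL p) s br"
      by (intro SL_isomorphic_if_table) (auto simp: leibniz_algebra_def)
    moreover obtain q where "q \<in> SLeib5_list" "leibniz_isomorphic (*s) (SL q) (*s) (SL p)"
      using SL_isomorphic_normal_form by blast
    ultimately show "\<exists>p\<in>SLeib5_list. leibniz_isomorphic s br (*s) (SL p)"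
      \<comment> \<open>The maps run from \<open>SL q\<close> through \<open>SL p\<close> to
        \<open>br\<close>, so the direction has to be reversed.\<close>
      using leibniz_isomorphic_sym leibniz_isomorphic_trans by blast
  qed
  show "\<forall>p\<in>SLeib5_list. leibniz_algebra (*s) (SL p)"
    by (simp add: leibniz_algebra_SL)
  show "pairwise (\<lambda>p q. \<not> leibniz_isomorphic (*s) (SL p) (*s) (SL q)) SLeib5_list"
    unfolding pairwise_def using SLeib5_list_eqI by blast
qed

end
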